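(* Let $a,b\in\mathbb{C}$ with $|a|^2-|b|^2=1$ and let $\phi(z)=\frac{az+b}{\overline{b}z+\overline{a}}$ for $z\in\mathbb{D}$. If $b=0$, then the Berezin range of the composition operator $C_\phi$ acting on the Hardy space $H^2(\mathbb{D})$ is convex if and only if $a\in\{1,-1,i,-i\}$.
   Context: $\mathbb{D}$ is the open unit disc in $\mathbb{C}$. $H^2(\mathbb{D})$ is the Hilbert space of holomorphic functions $f(z)=\sum_{n\ge0}a_nz^n$ on $\mathbb{D}$ with $\sum_n|a_n|^2<\infty$, with inner product $\langle \sum a_nz^n,\sum b_nz^n\rangle=\sum a_n\overline{b_n}$; its reproducing kernel at $w\in\mathbb{D}$ is $k_w(z)=\frac{1}{1-\overline{w}z}$. The normalized reproducing kernel is $\hat{k}_w=k_w/\|k_w\|$. The composition operator is $C_\phi f=f\circ\phi$. The Berezin range of a bounded operator $T$ on $H^2(\mathbb{D})$ is $\mathrm{Ber}(T)=\{\langle T\hat{k}_w,\hat{k}_w\rangle : w\in\mathbb{D}\}\subseteq\mathbb{C}$. *)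

theory Defs
  imports "HOL-Complex_Analysis.Complex_Analysis" "HOL-Library.FuncSet"
begin

abbreviation unit_disc :: "complex set" where
  "unit_disc \<equiv> ball 0 1"

definition taylor_coeff :: "(complex \<Rightarrow> complex) \<Rightarrow> nat \<Rightarrow> complex" where
  "taylor_coeff f n = fps_nth (fps_expansion f 0) n"

(* A function on the disc is represented by a total function that is extensional on the disc
   (equal to undefined elsewhere), so that equality of elements is equality on the disc. *)

definition hardy_space :: "(complex \<Rightarrow> complex) set" where
  "hardy_space = {f \<in> extensional unit_disc.
     f holomorphic_on unit_disc \<and> summable (\<lambda>n. (cmod (taylor_coeff f n))\<^sup>2)}"

definition hardy_inner :: "(complex \<Rightarrow> complex) \<Rightarrow> (complex \<Rightarrow> complex) \<Rightarrow> complex" where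
  "hardy_inner f g = (\<Sum>n. taylor_coeff f n * cnj (taylor_coeff g n))"

definition hardy_norm :: "(complex \<Rightarrow> complex) \<Rightarrow> real" where
  "hardy_norm f = sqrt (Re (hardy_inner f f))"

definition repr_kernel :: "complex \<Rightarrow> complex \<Rightarrow> complex" where
  "repr_kernel w = (\<lambda>z\<in>unit_disc. 1 / (1 - cnj w * z))"

definition normalized_kernel :: "complex \<Rightarrow> complex \<Rightarrow> complex" where
  "normalized_kernel w =
     (\<lambda>z\<in>unit_disc. repr_kernel w z / of_real (hardy_norm (repr_kernel w)))"

definition composition_operator ::
    "(complex \<Rightarrow> complex) \<Rightarrow> (complex \<Rightarrow> complex) \<Rightarrow> (complex \<Rightarrow> complex)" where
  "composition_operator \<phi> = (\<lambda>f\<in>hardy_space. compose unit_disc f \<phi>)"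

(* Meaningful for (bounded) operators T on hardy_space; only the values of T on the
   normalized kernels matter. *)

definition berezin_range ::
    "((complex \<Rightarrow> complex) \<Rightarrow> (complex \<Rightarrow> complex)) \<Rightarrow> complex set" where
  "berezin_range T =
     {hardy_inner (T (normalized_kernel w)) (normalized_kernel w) | w. w \<in> unit_disc}"

end

(* On the normalized kernels the composition operator with \<open>z \<mapsto> \<zeta> z\<close>, where
   \<open>\<zeta> = a / cnj a = a\<^sup>2\<close>, gives the curve \<open>(1 - t) / (1 - \<zeta> t)\<close> with \<open>t = |w|\<^sup>2\<close>. Its reciprocals
   form the ray \<open>1 + (1 - \<zeta>) s\<close>, \<open>s \<ge> 0\<close>. For \<open>\<zeta> = 1\<close> the curve is a point and for \<open>\<zeta> = -1\<close> it is
   the segment \<open>(0, 1]\<close>; otherwise it is a proper circular arc, which already misses the midpoint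
   of a chord from the endpoint 1. *)
theory Submission
  imports Defs
begin

text \<open>The geometric series gives the expansion. Agreement on the disc suffices, as it contains
  a neighbourhood of 0; kernels and their rotations are covered alike, whatever their values off the
  disc.\<close>

lemma taylor_coeff_geometric:
  assumes "\<And>z. z \<in> unit_disc \<Longrightarrow> f z = k / (1 - c * z)"
  shows "taylor_coeff f n = k * c ^ n"
proof -
  have "(\<lambda>z. k / (1 - c * z)) has_fps_expansion (fps_const k / (1 - fps_const c * fps_X))"
    by (intro fps_expansion_intros has_fps_expansion_divide') auto
  moreover have "fps_const k / (1 - fps_const c * fps_X) = fps_const k * Abs_fps (\<lambda>n. c ^ n)"
    \<comment> \<open>\<open>gp\<close> sums the formal geometric series in
      \<open>fps_const c * fps_X\<close>; substituting a multiple of \<open>fps_X\<close> scales the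
      nth coefficient by \<open>c ^ n\<close>.\<close>
    using gp[of "fps_const c * fps_X"]
    by (simp add: fps_compose_linear fps_divide_unit)
  moreover have "eventually (\<lambda>z. f z = k / (1 - c * z)) (nhds 0)"
    using eventually_nhds_in_open[of unit_disc "0::complex"] assms
    by (auto elim!: eventually_mono)
  ultimately have "f has_fps_expansion fps_const k * Abs_fps (\<lambda>n. c ^ n)"
    by (subst has_fps_expansion_cong[OF _ refl]) auto
  then have "fps_expansion f 0 = fps_const k * Abs_fps (\<lambda>n. c ^ n)"
    by (rule fps_expansion_eqI)
  then show ?thesis
    by (simp add: taylor_coeff_def)
qed

text \<open>Termwise, the coefficients form a geometric series with ratio \<open>c * cnj d\<close>,
  of modulus below 1. Both the kernel norm and the Berezin values are instances.\<close>

lemma hardy_inner_geometric: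
  assumes "\<And>z. z \<in> unit_disc \<Longrightarrow> f z = k / (1 - c * z)"
    and "\<And>z. z \<in> unit_disc \<Longrightarrow> g z = l / (1 - d * z)"
    and "cmod c < 1" "cmod d < 1"
  shows "hardy_inner f g = k * cnj l / (1 - c * cnj d)"
proof -
  have "cmod (c * cnj d) < 1"
    using assms(3,4) mult_strict_mono'[of "cmod c" 1 "cmod d" 1] by (simp add: norm_mult)
  then have "(\<lambda>n. k * cnj l * (c * cnj d) ^ n) sums (k * cnj l * (1 / (1 - c * cnj d)))"
    by (intro sums_mult geometric_sums)
  moreover have "(\<lambda>n. taylor_coeff f n * cnj (taylor_coeff g n))
      = (\<lambda>n. k * cnj l * (c * cnj d) ^ n)"
    using taylor_coeff_geometric[of f k c, OF assms(1)] taylor_coeff_geometric[of g l d, OF assms(2)]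
    by (simp add: fun_eq_iff power_mult_distrib mult_ac)
  ultimately show ?thesis
    unfolding hardy_inner_def by (simp add: sums_iff)
qed

lemma cmod_sq_less_1: "w \<in> unit_disc \<Longrightarrow> (cmod w)\<^sup>2 < 1"
  by (simp add: power_less_one_iff)

lemma hardy_norm_repr_kernel:
  assumes "w \<in> unit_disc"
  shows "hardy_norm (repr_kernel w) = 1 / sqrt (1 - (cmod w)\<^sup>2)"
proof -
  have "hardy_inner (repr_kernel w) (repr_kernel w) = 1 * cnj 1 / (1 - cnj w * cnj (cnj w))"
    using assms by (intro hardy_inner_geometric) (auto simp: repr_kernel_def)
  also have "\<dots> = of_real (1 / (1 - (cmod w)\<^sup>2))"
    by (simp add: mult.commute[of "cnj w"] flip: complex_norm_square)
  finally show ?thesis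
    by (simp add: hardy_norm_def real_sqrt_divide)
qed

lemma normalized_kernel_apply:
  assumes "w \<in> unit_disc" "z \<in> unit_disc"
  shows "normalized_kernel w z = of_real (sqrt (1 - (cmod w)\<^sup>2)) / (1 - cnj w * z)"
proof -
  have "normalized_kernel w z = repr_kernel w z / of_real (1 / sqrt (1 - (cmod w)\<^sup>2))"
    using assms by (simp add: normalized_kernel_def hardy_norm_repr_kernel)
  then show ?thesis
    using assms by (simp add: repr_kernel_def)
qed

text \<open>Needed because \<open>composition_operator\<close> is restricted to
  \<open>hardy_space\<close>: it can be unfolded to a composition only on members.\<close>

lemma normalized_kernel_in_hardy_space:
  assumes "w \<in> unit_disc"
  shows "normalized_kernel w \<in> hardy_space"
proof -
  define k where "k = complex_of_real (sqrt (1 - (cmod w)\<^sup>2))"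
  have eq: "normalized_kernel w z = k / (1 - cnj w * z)" if "z \<in> unit_disc" for z
    using normalized_kernel_apply[OF assms that] by (simp add: k_def)
  have "1 - cnj w * z \<noteq> 0" if "z \<in> unit_disc" for z
  proof
    assume "1 - cnj w * z = 0"
    then have "cmod w * cmod z = 1"
      by (metis complex_mod_cnj norm_mult norm_one right_minus_eq)
    then show False
      using assms that mult_strict_mono'[of "cmod w" 1 "cmod z" 1] by simp
  qed
  then have "(\<lambda>z. k / (1 - cnj w * z)) holomorphic_on unit_disc"
    by (intro holomorphic_intros) auto
  then have "normalized_kernel w holomorphic_on unit_disc"
    by (rule holomorphic_transform) (simp add: eq)
  moreover have "summable (\<lambda>n. (cmod (taylor_coeff (normalized_kernel w) n))\<^sup>2)"
  proof -
    have "summable (\<lambda>n. (cmod k)\<^sup>2 * ((cmod w)\<^sup>2) ^ n)"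
      using cmod_sq_less_1[OF assms] by (intro summable_mult summable_geometric) simp
    moreover have "taylor_coeff (normalized_kernel w) n = k * cnj w ^ n" for n
      using eq by (rule taylor_coeff_geometric)
    ultimately show ?thesis
      by (simp add: norm_mult norm_power power_mult_distrib mult.commute flip: power_mult)
  qed
  ultimately show ?thesis
    by (simp add: hardy_space_def normalized_kernel_def)
qed

text \<open>A rotation only replaces the parameter \<open>cnj w\<close> of the kernel by
  \<open>cnj w * \<zeta>\<close>, so the inner product is again geometric and depends on
  \<open>w\<close> through its squared modulus alone, which sweeps out
  \<open>{0..<1}\<close>.\<close>

lemma berezin_range_rotation:
  assumes "cmod \<zeta> = 1" and \<phi>: "\<And>z. z \<in> unit_disc \<Longrightarrow> \<phi> z = \<zeta> * z"
  shows "berezin_range (composition_operator \<phi>)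
    = (\<lambda>t. of_real (1 - t) / (1 - \<zeta> * of_real t)) ` {0..<1::real}"
proof -
  have val: "hardy_inner (composition_operator \<phi> (normalized_kernel w)) (normalized_kernel w)
      = of_real (1 - (cmod w)\<^sup>2) / (1 - \<zeta> * of_real ((cmod w)\<^sup>2))" (is "?lhs = _")
    if w: "w \<in> unit_disc" for w
  proof -
    define k where "k = complex_of_real (sqrt (1 - (cmod w)\<^sup>2))"
    have "?lhs = k * cnj k / (1 - (cnj w * \<zeta>) * cnj (cnj w))"
    proof (rule hardy_inner_geometric)
      show "composition_operator \<phi> (normalized_kernel w) z = k / (1 - cnj w * \<zeta> * z)"
        if z: "z \<in> unit_disc" for z
      proof -
        have "\<zeta> * z \<in> unit_disc"
          using z assms(1) by (simp add: norm_mult)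
        then show ?thesis
          using normalized_kernel_apply[OF w] z
          by (simp add: composition_operator_def normalized_kernel_in_hardy_space[OF w]
              compose_def \<phi> k_def mult_ac)
      qed
    qed (use w assms(1) in \<open>auto simp: normalized_kernel_apply k_def norm_mult\<close>)
    also have "k * cnj k = of_real (1 - (cmod w)\<^sup>2)"
      using cmod_sq_less_1[OF w] by (simp add: k_def flip: of_real_mult)
    also have "(cnj w * \<zeta>) * cnj (cnj w) = \<zeta> * of_real ((cmod w)\<^sup>2)"
      by (simp add: complex_norm_square[of w] mult_ac del: of_real_power)
    finally show ?thesis .
  qed
  have "(\<lambda>w. (cmod w)\<^sup>2) ` unit_disc = {0..<1}"
  proof
    show "{0..<1} \<subseteq> (\<lambda>w. (cmod w)\<^sup>2) ` unit_disc"
    proof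
      fix t :: real assume "t \<in> {0..<1}"
      then show "t \<in> (\<lambda>w. (cmod w)\<^sup>2) ` unit_disc"
        by (intro image_eqI[of _ _ "of_real (sqrt t)"]) auto
    qed
  qed (use cmod_sq_less_1 in auto)
  then have "(\<lambda>t. of_real (1 - t) / (1 - \<zeta> * of_real t)) ` {0..<1::real}
      = (\<lambda>w. of_real (1 - (cmod w)\<^sup>2) / (1 - \<zeta> * of_real ((cmod w)\<^sup>2))) ` unit_disc"
    by (simp only: image_image flip: \<open>_ ` unit_disc = _\<close>)
  also have "\<dots> = berezin_range (composition_operator \<phi>)"
    unfolding berezin_range_def Setcompr_eq_image using val by (intro image_cong) simp_all
  finally show ?thesis ..
qed

text \<open>Write \<open>1 - \<zeta> * t\<close> as \<open>(1 - t) + (1 - \<zeta>) * t\<close> and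
  divide by \<open>1 - t\<close>.\<close>

lemma inverse_on_ray:
  fixes \<zeta> :: complex and t :: real
  assumes "t < 1"
  shows "inverse (of_real (1 - t) / (1 - \<zeta> * of_real t)) = 1 + (1 - \<zeta>) * of_real (t / (1 - t))"
proof -
  have "complex_of_real (1 - t) \<noteq> 0"
    using assms by (simp only: of_real_eq_0_iff)
  then show ?thesis
    by (simp add: field_simps)
qed

lemma convex_rotation_curve_imp_real:
  assumes "cmod \<zeta> = 1"
    and conv: "convex ((\<lambda>t. of_real (1 - t) / (1 - \<zeta> * of_real t)) ` {0..<1::real})"
      (is "convex (?g ` _)")
  shows "\<zeta> \<in> \<real>"
proof -
  define c where "c = 1 - \<zeta>"
  have ray: "inverse (?g t) = 1 + c * of_real (t / (1 - t))" if "t < 1" for t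
    using inverse_on_ray[OF that] by (simp add: c_def)
  have "1 \<in> ?g ` {0..<1}"
    by (rule image_eqI[of _ _ 0]) auto
  \<comment> \<open>At parameter 1/2 the ray coordinate \<open>t / (1 - t)\<close> equals 1, so this
    chord end has the simple reciprocal \<open>1 + c\<close>.\<close>
  moreover have "?g (1/2) \<in> ?g ` {0..<1}"
    by (rule imageI) auto
  ultimately have "(1/2) *\<^sub>R 1 + (1/2) *\<^sub>R ?g (1/2) \<in> ?g ` {0..<1}"
    by (intro convexD[OF conv]) auto
  then obtain t where t: "0 \<le> t" "t < 1" "(1/2) *\<^sub>R 1 + (1/2) *\<^sub>R ?g (1/2) = ?g t"
    by auto
  define s where "s = t / (1 - t)"
  have g_half: "?g (1/2) = inverse (1 + c)"
    using ray[of "1/2"] by (subst inverse_inverse_eq[symmetric]) simp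
  have g_t: "?g t = inverse (1 + c * of_real s)"
    using ray[OF t(2)] by (subst inverse_inverse_eq[symmetric]) (simp only: s_def)
  have mid: "(1 + inverse (1 + c)) / 2 = inverse (1 + c * of_real s)"
    using t(3) unfolding g_half g_t by (simp add: scaleR_conv_of_real add_divide_distrib)
  \<comment> \<open>These are \<open>2 - \<zeta>\<close> and \<open>3 - \<zeta>\<close>, nonzero
    because \<open>\<zeta>\<close> has modulus 1.\<close>
  have ne: "1 + c \<noteq> 0" "2 + c \<noteq> 0"
    using assms(1) by (auto simp: c_def algebra_simps)
  then have "(1 + inverse (1 + c)) / 2 = (2 + c) / (2 * (1 + c))"
    by (simp add: field_simps)
  with mid have mid': "(2 + c) / (2 * (1 + c)) = 1 / (1 + c * of_real s)"
    by (simp only: inverse_eq_divide)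
  have nz: "2 * (1 + c) \<noteq> 0"
    using ne(1) by (simp del: distrib_left_numeral)
  \<comment> \<open>A zero denominator would make the right side of \<open>mid'\<close> equal to 0
    by the convention for division by zero, but the left side is nonzero.\<close>
  with mid' have "1 + c * of_real s \<noteq> 0"
    using ne(2) by (metis divide_eq_0_iff div_by_0)
  with mid' nz have "(2 + c) * (1 + c * of_real s) = 1 * (2 * (1 + c))"
    by (metis frac_eq_eq)
  \<comment> \<open>Expanding the cross-multiplied equation and cancelling leaves this factored
    form. As \<open>s\<close> is real, either factor vanishing forces \<open>c\<close>, hence
    \<open>\<zeta>\<close>, to be real.\<close>
  then have "c * ((2 + c) * of_real s - 1) = 0"
    by (simp add: algebra_simps)
  then consider "c = 0" | "(2 + c) * of_real s = 1"
    by auto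
  then show ?thesis
  proof cases
    case 1
    then show ?thesis by (simp add: c_def)
  next
    case 2
    then have "s \<noteq> 0"
      by auto
    with 2 have "2 + c = of_real (1 / s)"
      by (simp add: nonzero_eq_divide_eq)
    then have "\<zeta> = of_real (3 - 1 / s)"
      by (simp add: c_def algebra_simps)
    then show ?thesis
      by simp
  qed
qed

text \<open>The values are real and fill the interval \<open>{0<..1}\<close>, whose image under the
  linear embedding into the complex plane is convex.\<close>

lemma convex_reflection_curve:
  "convex ((\<lambda>t. of_real (1 - t) / (1 + of_real t) :: complex) ` {0..<1::real})"
proof -
  have "(\<lambda>t::real. (1 - t) / (1 + t)) ` {0..<1} = {0<..1}"
  proof
    show "{0<..1} \<subseteq> (\<lambda>t::real. (1 - t) / (1 + t)) ` {0..<1}"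
    proof
      fix x :: real assume "x \<in> {0<..1}"
      then show "x \<in> (\<lambda>t. (1 - t) / (1 + t)) ` {0..<1}"
        \<comment> \<open>The map \<open>(1 - t) / (1 + t)\<close> is its own inverse, which
          supplies the witness.\<close>
        by (intro image_eqI[of _ _ "(1 - x) / (1 + x)"]) (auto simp: field_simps)
    qed
  qed (auto simp: field_simps)
  then have "(\<lambda>t. of_real (1 - t) / (1 + of_real t) :: complex) ` {0..<1::real}
      = of_real ` {0<..1}"
    by (simp add: image_image flip: \<open>_ = {0<..1}\<close>)
  moreover have "convex (complex_of_real ` {0<..1})"
    by (intro convex_linear_image convex_real_interval linear_of_real)
  ultimately show ?thesis by simp
qed

theorem mainTheorem6:
  fixes a b :: complex and \<phi> :: "complex \<Rightarrow> complex"
  assumes "(cmod a)\<^sup>2 - (cmod b)\<^sup>2 = 1"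
    and "\<And>z. z \<in> unit_disc \<Longrightarrow> \<phi> z = (a * z + b) / (cnj b * z + cnj a)"
    and "b = 0"
  shows "convex (berezin_range (composition_operator \<phi>)) \<longleftrightarrow> a \<in> {1, -1, \<i>, -\<i>}"
proof -
  define \<zeta> where "\<zeta> = a\<^sup>2"
  have "cmod a = 1"
    using assms(1,3) by (simp add: power2_eq_1_iff norm_ge_zero) (smt (verit) norm_ge_zero)
  then have \<zeta>1: "cmod \<zeta> = 1" and "a \<noteq> 0" and "a * cnj a = 1"
    by (auto simp: \<zeta>_def norm_power simp flip: complex_norm_square)
  then have "\<phi> z = \<zeta> * z" if "z \<in> unit_disc" for z
  proof -
    \<comment> \<open>On the unit circle \<open>cnj a\<close> is the inverse of \<open>a\<close>, so
      the given map is rotation by \<open>a\<^sup>2\<close>.\<close>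
    have "a / cnj a = a\<^sup>2"
      using \<open>a \<noteq> 0\<close> \<open>a * cnj a = 1\<close> by (simp add: power2_eq_square divide_eq_eq mult.assoc)
    then show ?thesis
      using assms(2)[OF that] \<open>b = 0\<close> by (simp add: \<zeta>_def flip: times_divide_eq_left)
  qed
  from berezin_range_rotation[OF \<zeta>1 this]
  have ber: "berezin_range (composition_operator \<phi>)
      = (\<lambda>t. of_real (1 - t) / (1 - \<zeta> * of_real t)) ` {0..<1::real}" .
  have "\<zeta> = 1 \<or> \<zeta> = - 1" if "\<zeta> \<in> \<real>"
    using that \<zeta>1 by (auto elim!: Reals_cases simp: abs_if split: if_splits)
  then have "convex (berezin_range (composition_operator \<phi>)) \<Longrightarrow> \<zeta> = 1 \<or> \<zeta> = - 1"
    using convex_rotation_curve_imp_real[OF \<zeta>1] ber by simp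
  moreover have "convex (berezin_range (composition_operator \<phi>))" if "\<zeta> = 1"
  proof -
    have "of_real (1 - t) / (1 - 1 * of_real t) = (1::complex)" if "t \<in> {0..<1}" for t :: real
    proof -
      have "of_real (1 - t) \<noteq> (0::complex)"
        using that by (simp only: of_real_eq_0_iff) simp
      then show ?thesis by simp
    qed
    then have "berezin_range (composition_operator \<phi>) = (\<lambda>_. 1) ` {0..<1::real}"
      unfolding ber \<open>\<zeta> = 1\<close> by (rule image_cong[OF refl])
    then show ?thesis
      by (simp add: image_constant_conv)
  qed
  moreover have "convex (berezin_range (composition_operator \<phi>))" if "\<zeta> = - 1"
    using convex_reflection_curve that ber by simp
  moreover have "\<zeta> = 1 \<longleftrightarrow> a = 1 \<or> a = - 1"
    by (simp add: \<zeta>_def power2_eq_1_iff)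
  moreover have "\<zeta> = - 1 \<longleftrightarrow> a = \<i> \<or> a = - \<i>"
    using power2_eq_iff[of a \<i>] by (simp add: \<zeta>_def)
  ultimately show ?thesis
    by blast
qed

end
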